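(* For every $r\ge0$ and $0\le i\le r$ there is a bijection $$\Phi:\mathcal{U}^i_{\mathrm{Car}_{r+3}}(1,1,\ldots,1)\longrightarrow\mathcal{M}(r,i)$$ from the set of level-$i$ refined unified diagrams of the caracol graph to the set of multi-labeled Dyck paths. Hence, with $T(r,i)=\big|\mathcal{U}^i_{\mathrm{Car}_{r+3}}(1,1,\ldots,1)\big|$, one has $|\mathcal{M}(r,i)|=T(r,i)$ for $0\le i\le r$.
   Context: Put $n=r+2$. The caracol graph $\mathrm{Car}_{n+1}=\mathrm{Car}_{r+3}$ is the directed graph on $\{1,\ldots,n+1\}$ with edges $(1,j)$ for $2\le j\le n$, $(i,i+1)$ for $2\le i\le n$, and $(i,n+1)$ for $2\le i\le n-1$. Its shifted out-degree vector (entries: out-degree of $i$ minus $1$, for $i=1,\ldots,n$) is $\mathbf{t}=(r,1,\ldots,1,0)$, with $|\mathbf{t}|=2r$. Its restriction $(\mathrm{Car}_{n+1})|_n$ to the vertices $1,\ldots,n$ has edges $(1,j)$, $2\le j\le n$, and $(i,i+1)$, $2\le i\le n-1$. A $\mathbf{t}$-Dyck path is a sequence of nonnegative integers $\mathbf{s}=(s_1,\ldots,s_n)$ with sum $|\mathbf{t}|$ and $\sum_{j\le k}s_j\ge\sum_{j\le k}t_j$ for all $k$, identified with the lattice path $N^{s_1}EN^{s_2}E\cdots N^{s_n}E$. Gravity diagrams: for a graph $H$ on $[n]$ (edges directed from smaller to larger vertices) and $\mathbf{v}\in\mathbb{Z}^n$ with entry sum $0$, write $\mathbf{v}=\sum_{k=1}^{n-1}d_k\boldsymbol{\alpha}_k$,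 $\boldsymbol{\alpha}_k=\mathbf{e}_k-\mathbf{e}_{k+1}$. A line-dot diagram is a partition of an array of dots with $d_k$ dots in column $k$ (none exists if some $d_k<0$) into lines, each line assigned to an edge $(p,q)$ of $H$ and consisting of exactly one dot from each of the columns $p,\ldots,q-1$. Two are equivalent if each edge is assigned the same number of lines in both. $\mathcal{GD}_H(\mathbf{v})$ is the set of equivalence classes; equivalently it is the set of ways of writing $\mathbf{v}$ as a nonnegative integer combination of the vectors $\mathbf{e}_p-\mathbf{e}_q$, $(p,q)\in E(H)$. Level-$i$ refined unified diagrams: $\mathcal{U}^i_{\mathrm{Car}_{r+3}}(1,\ldots,1)$ is the set of triples $(\mathbf{s},\sigma,D)$ where $\mathbf{s}$ is a $\mathbf{t}$-Dyck path with $s_1=|\mathbf{t}|-i$, $\sigma$ is a permutation of $[i]$ labeling the $i$ north steps not in the first column, with labels increasing along consecutive north steps in each column, and $D\in\mathcal{GD}_{(\mathrm{Car}_{r+3})|_{r+2}}(\mathbf{s}-\mathbf{t})$. Multi-labeled Dyck paths: $\mathcal{M}(r,i)$ is the set of Dyck paths from $(0,0)$ to $(r,r)$ (north and east unit steps, staying weakly above the diagonal) whose $r$ north steps are labeled by the multiset $\{0^{r-i},1,\ldots,i\}$ ($r-i$ copies of $0$ and one each of $1,\ldots,i$) such that labels on consecutive north steps are non-decreasing. *)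

theory Defs
  imports "HOL-Library.Disjoint_Sets" "HOL-Combinatorics.Multiset_Permutations"
begin

text \<open>
  A directed graph on the vertices \<open>1, \<dots>, m\<close> without multiple edges is its set of edges.
  Vectors in \<open>\<int>\<^sup>n\<close> are lists of length \<open>n\<close>, so entry \<open>v\<^sub>k\<close> is \<open>v ! (k - 1)\<close>
  and \<open>v\<^sub>1 + \<dots> + v\<^sub>k\<close> is \<open>sum_list (take k v)\<close>.
\<close>

definition caracol :: "nat \<Rightarrow> (nat \<times> nat) set" where
  "caracol m =
     {(1, j) | j. 2 \<le> j \<and> j \<le> m - 1} \<union>
     {(i, i + 1) | i. 2 \<le> i \<and> i \<le> m - 1} \<union>
     {(i, m) | i. 2 \<le> i \<and> i \<le> m - 2}"

definition shifted_outdegrees :: "(nat \<times> nat) set \<Rightarrow> nat \<Rightarrow> int list" where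
  "shifted_outdegrees G n = map (\<lambda>i. int (card {q. (i, q) \<in> G}) - 1) [1..<n + 1]"


subsection \<open>Lattice paths\<close>

datatype step = North | East

definition lattice_path :: "nat list \<Rightarrow> step list" where
  "lattice_path s = concat (map (\<lambda>a. replicate a North @ [East]) s)"

definition dyck_paths_of :: "int list \<Rightarrow> nat list set" where
  "dyck_paths_of t = {s. length s = length t \<and> int (sum_list s) = sum_list t \<and>
     (\<forall>k \<le> length t. sum_list (take k t) \<le> int (sum_list (take k s)))}"

text \<open>
  The list \<open>xs\<close> gives the labels of the north steps of \<open>w\<close> in the order in which the path
  visits them, so the north step at position \<open>p\<close> of \<open>w\<close> has the label whose index is the number
  of north steps before \<open>p\<close>.
\<close>

definition labels_along :: "(nat \<Rightarrow> nat \<Rightarrow> bool) \<Rightarrow> step list \<Rightarrow> nat list \<Rightarrow> bool" where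
  "labels_along R w xs \<longleftrightarrow>
     (\<forall>p. Suc p < length w \<longrightarrow> w ! p = North \<longrightarrow> w ! Suc p = North \<longrightarrow>
        R (xs ! count_list (take p w) North) (xs ! count_list (take (Suc p) w) North))"


subsection \<open>Gravity diagrams\<close>

text \<open>
  The coefficient \<open>d\<^sub>k\<close> of \<open>\<alpha>\<^sub>k = e\<^sub>k - e\<^bsub>k+1\<^esub>\<close> in a vector with entry sum \<open>0\<close>; see
  \<open>simple_root_expansion\<close> below.
\<close>

definition root_coeff :: "int list \<Rightarrow> nat \<Rightarrow> int" where
  "root_coeff v k = sum_list (take k v)"

lemma simple_root_expansion:
  assumes "sum_list v = 0" and "1 \<le> j" and "j \<le> length v"
  shows "v ! (j - 1) =
    (\<Sum>k = 1..<length v. root_coeff v k * (of_bool (j = k) - of_bool (j = k + 1)))"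
proof -
  have split: "{1..<length v} \<inter> {k. j = k} = (if j < length v then {j} else {})"
    "{1..<length v} \<inter> {k. j = k + 1} = (if 1 < j then {j - 1} else {})"
    using assms by auto
  have "(\<Sum>k = 1..<length v. root_coeff v k * (of_bool (j = k) - of_bool (j = k + 1))) =
      (\<Sum>k = 1..<length v. root_coeff v k * of_bool (j = k)) -
      (\<Sum>k = 1..<length v. root_coeff v k * of_bool (j = k + 1))"
    by (simp add: right_diff_distrib sum_subtractf)
  also have "\<dots> = root_coeff v j - root_coeff v (j - 1)"
  proof -
    have "(\<Sum>k = 1..<length v. root_coeff v k * of_bool (j = k)) = root_coeff v j"
      using assms split(1) by (auto simp: sum_mult_of_bool_eq root_coeff_def split: if_splits)
    moreover have "(\<Sum>k = 1..<length v. root_coeff v k * of_bool (j = k + 1)) =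
        root_coeff v (j - 1)"
      unfolding sum_mult_of_bool_eq[OF finite_atLeastLessThan] split(2)
      using assms by (auto simp: root_coeff_def)
    ultimately show ?thesis by simp
  qed
  also have "\<dots> = v ! (j - 1)"
    using assms take_Suc_conv_app_nth[of "j - 1" v] by (simp add: root_coeff_def)
  finally show ?thesis by simp
qed

definition dot_array :: "nat \<Rightarrow> int list \<Rightarrow> (nat \<times> nat) set" where
  "dot_array n v = {(k, j). 1 \<le> k \<and> k < n \<and> int j < root_coeff v k}"

definition is_line :: "nat \<times> nat \<Rightarrow> (nat \<times> nat) set \<Rightarrow> bool" where
  "is_line e B \<longleftrightarrow> fst ` B = {fst e..<snd e} \<and> inj_on fst B"

text \<open>
  Edges satisfy \<open>p < q\<close> and are not repeated, so the edge to which a line is assigned is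
  determined by the columns the line meets and need not be recorded.
\<close>

definition line_dot_diagrams ::
  "(nat \<times> nat) set \<Rightarrow> nat \<Rightarrow> int list \<Rightarrow> (nat \<times> nat) set set set" where
  "line_dot_diagrams H n v = {P. (\<forall>k \<in> {1..<n}. 0 \<le> root_coeff v k) \<and>
     partition_on (dot_array n v) P \<and> (\<forall>B \<in> P. \<exists>e \<in> H. is_line e B)}"

definition line_dot_equiv ::
  "(nat \<times> nat) set \<Rightarrow> nat \<Rightarrow> int list \<Rightarrow> ((nat \<times> nat) set set \<times> (nat \<times> nat) set set) set" where
  "line_dot_equiv H n v = {(P, Q). P \<in> line_dot_diagrams H n v \<and> Q \<in> line_dot_diagrams H n v \<and>
     (\<forall>e \<in> H. card {B \<in> P. is_line e B} = card {B \<in> Q. is_line e B})}"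

definition gravity_diagrams ::
  "(nat \<times> nat) set \<Rightarrow> nat \<Rightarrow> int list \<Rightarrow> (nat \<times> nat) set set set set" where
  "gravity_diagrams H n v = line_dot_diagrams H n v // line_dot_equiv H n v"


subsection \<open>Refined unified diagrams and multi-labeled Dyck paths\<close>

text \<open>
  For a graph \<open>G\<close> on \<open>1, \<dots>, n + 1\<close> and net flow \<open>(1, \<dots>, 1)\<close>.  The permutation \<open>\<sigma>\<close> is in
  one-line notation; removing the first column of the path of \<open>s\<close> leaves the path of \<open>tl s\<close>.
\<close>

definition refined_unified_diagrams ::
  "(nat \<times> nat) set \<Rightarrow> nat \<Rightarrow> nat \<Rightarrow>
     (nat list \<times> nat list \<times> (nat \<times> nat) set set set) set" where
  "refined_unified_diagrams G n i = (let t = shifted_outdegrees G n in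
     {(s, \<sigma>, D). s \<in> dyck_paths_of t \<and> int (s ! 0) = sum_list t - int i \<and>
        \<sigma> \<in> permutations_of_set {1..i} \<and> labels_along (<) (lattice_path (tl s)) \<sigma> \<and>
        D \<in> gravity_diagrams (Restr G {1..n}) n (map2 (\<lambda>a b. int a - b) s t)})"

definition T :: "nat \<Rightarrow> nat \<Rightarrow> nat" where
  "T r i = card (refined_unified_diagrams (caracol (r + 3)) (r + 2) i)"

definition dyck_words :: "nat \<Rightarrow> step list set" where
  "dyck_words r = {w. count_list w North = r \<and> count_list w East = r \<and>
     (\<forall>p \<le> length w. count_list (take p w) East \<le> count_list (take p w) North)}"

definition multi_labeled_dyck_paths :: "nat \<Rightarrow> nat \<Rightarrow> (step list \<times> nat list) set" where
  "multi_labeled_dyck_paths r i = {(w, xs). w \<in> dyck_words r \<and>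
     xs \<in> permutations_of_multiset (replicate_mset (r - i) 0 + mset_set {1..i}) \<and>
     labels_along (\<le>) w xs}"

lemma shifted_outdegrees_caracol:
  "shifted_outdegrees (caracol (r + 3)) (r + 2) = int r # replicate r 1 @ [0]"
proof (rule nth_equalityI)
  fix k assume "k < length (shifted_outdegrees (caracol (r + 3)) (r + 2))"
  then have k: "k < r + 2"
    by (simp add: shifted_outdegrees_def del: upt_Suc)
  consider "k = 0" | "1 \<le> k" "k \<le> r" | "k = r + 1"
    using k by linarith
  then have "{q. (k + 1, q) \<in> caracol (r + 3)} =
      (if k = 0 then {2..r + 2} else if k \<le> r then {k + 2, r + 3} else {r + 3})"
    by cases (auto simp: caracol_def)
  with k show "shifted_outdegrees (caracol (r + 3)) (r + 2) ! k =
      (int r # replicate r 1 @ [0]) ! k"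
    by (auto simp: shifted_outdegrees_def nth_Cons' nth_append simp del: upt_Suc)
qed (simp add: shifted_outdegrees_def del: upt_Suc)

lemma finite_multi_labeled_dyck_paths: "finite (multi_labeled_dyck_paths r i)"
proof -
  have len: "length w = count_list w North + count_list w East" for w
  proof (induction w)
    case (Cons a w)
    then show ?case by (cases a) auto
  qed simp
  have univ: "(UNIV :: step set) = {North, East}"
    using step.exhaust by auto
  have "dyck_words r \<subseteq> {w. set w \<subseteq> UNIV \<and> length w = r + r}"
    by (auto simp: dyck_words_def len)
  moreover have "finite {w. set w \<subseteq> (UNIV :: step set) \<and> length w = r + r}"
    by (rule finite_lists_length_eq) (simp add: univ)
  ultimately have "finite (dyck_words r)"
    by (rule finite_subset)
  moreover have "multi_labeled_dyck_paths r i \<subseteq>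
      dyck_words r \<times> permutations_of_multiset (replicate_mset (r - i) 0 + mset_set {1..i})"
    by (auto simp: multi_labeled_dyck_paths_def)
  ultimately show ?thesis
    by (meson finite_SigmaI finite_permutations_of_multiset finite_subset)
qed

end

theory Submission
  imports Defs
begin

text \<open>
  A gravity diagram of the restricted caracol graph is determined by the multiplicities \<open>b\<^sub>m\<close> of
  the lines assigned to the edges \<open>(1, m + 1)\<close>: these lines use up the first column, and each
  remaining dot is a line of its own, assigned to an edge \<open>(k, k + 1)\<close>.  All multiplicities occur
  for which no column is overfull; in particular \<open>b\<^bsub>r+1\<^esub> = 0\<close>, as column \<open>r + 1\<close> is empty.    If
  \<open>a\<^sub>1, \<dots>, a\<^sub>r\<close> are the north steps of the path outside its first column, the bound for column
  \<open>m + 1\<close> reads \<open>m \<le> (a\<^sub>1 + b\<^sub>1) + \<dots> + (a\<^sub>m + b\<^sub>m)\<close>.  This is the Dyck condition for the path whose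
  \<open>m\<close>-th column has \<open>b\<^sub>m\<close> north steps labeled \<open>0\<close> followed by the \<open>a\<^sub>m\<close> labeled north steps of
  the original path; it implies the condition that the original path is a \<open>t\<close>-Dyck path.
\<close>

subsection \<open>Labeled lattice paths\<close>

lemma lattice_path_simps [simp]:
  "lattice_path [] = []"
  "lattice_path (a # s) = replicate a North @ East # lattice_path s"
  by (simp_all add: lattice_path_def)

text \<open>Separating position 0 turns conditions on all positions of a path into recursions on its
  first step.\<close>

lemma all_nat_iff_0_Suc: "(\<forall>p. P p) \<longleftrightarrow> P 0 \<and> (\<forall>p. P (Suc p))"
  by (metis not0_implies_Suc)

lemma labels_along_East: "labels_along R (East # w) xs \<longleftrightarrow> labels_along R w xs"
  unfolding labels_along_def by (subst all_nat_iff_0_Suc) simp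

lemma labels_along_North_North:
  "labels_along R (North # North # w) (x # y # xs) \<longleftrightarrow>
     R x y \<and> labels_along R (North # w) (y # xs)"
  unfolding labels_along_def by (subst all_nat_iff_0_Suc) simp

lemma labels_along_North_East:
  "labels_along R (North # East # w) (x # xs) \<longleftrightarrow> labels_along R w xs"
proof -
  have "labels_along R (North # East # w) (x # xs) \<longleftrightarrow> labels_along R (East # w) xs"
    unfolding labels_along_def by (subst all_nat_iff_0_Suc) simp
  then show ?thesis by (simp add: labels_along_East)
qed

text \<open>Only labels of adjacent north steps are compared, so the East step that closes the
  column removes every relation between \<open>c\<close> and \<open>xs\<close>.\<close>

lemma labels_along_column:
  "labels_along R (replicate (length c) North @ East # w) (c @ xs) \<longleftrightarrow>
     successively R c \<and> labels_along R w xs"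
  by (induction c rule: induct_list012)
     (simp_all add: labels_along_East labels_along_North_North labels_along_North_East)

lemma labels_along_concat:
  assumes "transp R"
  shows "labels_along R (lattice_path (map length L)) (concat L) \<longleftrightarrow>
     (\<forall>c \<in> set L. sorted_wrt R c)"
proof (induction L)
  case Nil
  show ?case by (simp add: labels_along_def)
next
  case (Cons c L)
  then show ?case
    by (simp add: labels_along_column successively_conv_sorted_wrt[OF assms])
qed

lemma replicate_North_East_eq_iff:
  "replicate a North @ East # u = replicate b North @ East # v \<longleftrightarrow> a = b \<and> u = v"
proof (induction a arbitrary: b)
  case 0
  then show ?case by (cases b) auto
next
  case (Suc a)
  then show ?case by (cases b) auto
qed

lemma lattice_path_inject: "lattice_path s = lattice_path s' \<longleftrightarrow> s = s'"
proof (induction s arbitrary: s')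
  case Nil
  then show ?case by (cases s') auto
next
  case (Cons a s)
  then show ?case by (cases s') (auto simp: replicate_North_East_eq_iff)
qed

lemma count_list_replicate: "count_list (replicate n x) y = (if x = y then n else 0)"
  by (induction n) (auto split: if_splits)

lemma count_list_lattice_path:
  "count_list (lattice_path s) North = sum_list s"
  "count_list (lattice_path s) East = length s"
  by (induction s) (simp_all add: count_list_replicate)

text \<open>Prepending East adds an empty first column. Prepending North raises the first column,
  which exists because the rest of the word is nonempty and ends in East.\<close>

lemma ex_lattice_path:
  assumes "w = [] \<or> last w = East"
  obtains s where "w = lattice_path s"
proof -
  have "\<exists>s. w = lattice_path s"
    using assms
  proof (induction w)
    case Nil
    show ?case by (rule exI[of _ "[]"]) simp
  next
    case (Cons a w)
    from Cons.prems have "w = [] \<or> last w = East" by (cases "w = []") auto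
    with Cons.IH obtain s where s: "w = lattice_path s" by blast
    show ?case
    proof (cases a)
      case East
      then show ?thesis using s by (intro exI[of _ "0 # s"]) simp
    next
      case North
      with Cons.prems have "w \<noteq> []" by auto
      then obtain b s' where "s = b # s'" using s by (cases s) auto
      then show ?thesis using s North by (intro exI[of _ "Suc b # s'"]) simp
    qed
  qed
  then show ?thesis using that by blast
qed

section \<open>The Dyck condition in terms of column heights\<close>

lemma ballot_simps:
  fixes h :: int
  defines "ballot \<equiv> \<lambda>h w. \<forall>p \<le> length w.
    int (count_list (take p w) East) \<le> h + int (count_list (take p w) North)"
  shows "ballot h [] \<longleftrightarrow> 0 \<le> h"
    and "ballot h (replicate a North @ East # w) \<longleftrightarrow> 0 \<le> h \<and> ballot (h + int a - 1) w"
proof -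
  show "ballot h [] \<longleftrightarrow> 0 \<le> h" by (simp add: ballot_def)
  have E: "ballot h (East # w) \<longleftrightarrow> 0 \<le> h \<and> ballot (h - 1) w" for h w
    unfolding ballot_def by (subst all_nat_iff_0_Suc) (auto simp: algebra_simps)
  have N: "ballot h (North # w) \<longleftrightarrow> 0 \<le> h \<and> ballot (h + 1) w" for h w
    unfolding ballot_def by (subst all_nat_iff_0_Suc) (auto simp: algebra_simps)
  have nonneg: "0 \<le> h" if "ballot h w" for h w
    using that by (force simp: ballot_def)
  show "ballot h (replicate a North @ East # w) \<longleftrightarrow> 0 \<le> h \<and> ballot (h + int a - 1) w"
  proof (induction a arbitrary: h)
    case 0
    show ?case by (simp add: E)
  next
    case (Suc a)
    have "h + 1 + int a - 1 = h + int (Suc a) - 1" by simp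
    with Suc[of "h + 1"] have "ballot (h + 1) (replicate a North @ East # w) \<longleftrightarrow>
        0 \<le> h + 1 \<and> ballot (h + int (Suc a) - 1) w"
      by metis
    then show ?case by (auto simp: N)
  qed
qed

text \<open>North steps only help, so it suffices to look at the start and at the ends of columns.
  The offset \<open>h\<close> is kept general because the induction passes a whole column at a time,
  which changes it by \<open>a - 1\<close>.\<close>

lemma ballot_lattice_path_iff:
  fixes h :: int
  shows "(\<forall>p \<le> length (lattice_path s).
      int (count_list (take p (lattice_path s)) East) \<le>
      h + int (count_list (take p (lattice_path s)) North)) \<longleftrightarrow>
   (\<forall>m \<le> length s. int m \<le> h + int (sum_list (take m s)))"
proof (induction s arbitrary: h)
  case Nil
  show ?case by simp
next
  case (Cons a s)
  have "(\<forall>m \<le> length (a # s). int m \<le> h + int (sum_list (take m (a # s)))) \<longleftrightarrow>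
      0 \<le> h \<and> (\<forall>m \<le> length s. int m \<le> (h + int a - 1) + int (sum_list (take m s)))"
    by (subst all_nat_iff_0_Suc) (auto simp: algebra_simps)
  then show ?case
    by (simp only: lattice_path_simps ballot_simps Cons.IH)
qed

lemma dyck_words_eq:
  "dyck_words r =
     lattice_path ` {s. length s = r \<and> sum_list s = r \<and> (\<forall>m \<le> r. m \<le> sum_list (take m s))}"
proof (intro equalityI subsetI)
  fix w assume "w \<in> dyck_words r"
  then have w: "count_list w North = r" "count_list w East = r"
    "\<forall>p \<le> length w. count_list (take p w) East \<le> count_list (take p w) North"
    by (auto simp: dyck_words_def)
  \<comment> \<open>Before a final North step there would be \<open>r\<close> east steps but only
    \<open>r - 1\<close> north steps.\<close>
  have "w = [] \<or> last w = East"
  proof (rule ccontr)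
    assume "\<not> (w = [] \<or> last w = East)"
    then have "w = butlast w @ [North]"
      by (metis append_butlast_last_id step.exhaust)
    then obtain u where u: "w = u @ [North]" by blast
    have "count_list u East \<le> count_list u North"
      using w(3)[rule_format, of "length u"] by (simp add: u)
    with w(1,2) show False by (simp add: u)
  qed
  then obtain s where s: "w = lattice_path s" by (rule ex_lattice_path)
  have "length s = r" "sum_list s = r"
    using w(1,2) by (simp_all add: s count_list_lattice_path)
  moreover have "\<forall>m \<le> length s. m \<le> sum_list (take m s)"
    using w(3) ballot_lattice_path_iff[of s 0] by (simp add: s)
  ultimately show
    "w \<in> lattice_path ` {s. length s = r \<and> sum_list s = r \<and> (\<forall>m \<le> r. m \<le> sum_list (take m s))}"
    using s by blast
next
  fix w assume
    "w \<in> lattice_path ` {s. length s = r \<and> sum_list s = r \<and> (\<forall>m \<le> r. m \<le> sum_list (take m s))}"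
  then obtain s where "w = lattice_path s" "length s = r" "sum_list s = r"
    "\<forall>m \<le> length s. m \<le> sum_list (take m s)"
    by auto
  then show "w \<in> dyck_words r"
    using ballot_lattice_path_iff[of s 0] by (simp add: dyck_words_def count_list_lattice_path)
qed

subsection \<open>Dyck paths as lists of labeled columns\<close>

text \<open>A labeled Dyck path cut into the label lists of its columns. Their lengths encode the
  path, and the last clause is the Dyck condition at the ends of columns.\<close>

definition labelled_columns :: "nat \<Rightarrow> nat \<Rightarrow> nat list list set" where
  "labelled_columns r i = {L. length L = r \<and> (\<forall>c \<in> set L. sorted c) \<and>
     mset (concat L) = replicate_mset (r - i) 0 + mset_set {1..i} \<and>
     (\<forall>m \<le> r. m \<le> length (concat (take m L)))}"

lemma ex_concat_map_length:
  assumes "length xs = sum_list s"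
  obtains L where "concat L = xs" "map length L = s"
proof -
  have "\<exists>L. concat L = xs \<and> map length L = s"
    using assms
  proof (induction s arbitrary: xs)
    case Nil
    then show ?case by simp
  next
    case (Cons a s)
    then obtain L where "concat L = drop a xs" "map length L = s"
      by (metis add_diff_cancel_left' length_drop sum_list.Cons)
    with Cons.prems show ?case
      by (intro exI[of _ "take a xs # L"]) simp
  qed
  then show ?thesis using that by blast
qed

lemma concat_map_length_inject:
  assumes "concat L = concat L'" and "map length L = map length L'"
  shows "L = L'"
  using assms
proof (induction L arbitrary: L')
  case Nil
  then show ?case by simp
next
  case (Cons c L)
  then show ?case by (cases L') auto
qed

lemma bij_betw_labelled_columns_multi_labeled:
  assumes "i \<le> r"
  shows "bij_betw (\<lambda>L. (lattice_path (map length L), concat L))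
    (labelled_columns r i) (multi_labeled_dyck_paths r i)"
  unfolding bij_betw_def
proof (intro conjI inj_onI equalityI subsetI)
  fix L L' :: "nat list list"
  assume "(lattice_path (map length L), concat L) = (lattice_path (map length L'), concat L')"
  then show "L = L'"
    by (auto simp: lattice_path_inject intro: concat_map_length_inject)
next
  have le: "labels_along (\<le>) (lattice_path (map length L)) (concat L) \<longleftrightarrow>
      (\<forall>c \<in> set L. sorted c)" for L :: "nat list list"
    by (rule labels_along_concat) simp
  \<comment> \<open>The multiset of labels has (r - i) + i elements, which is \<open>r\<close>
    because \<open>i \<le> r\<close>.\<close>
  have len: "sum_list (map length L) = r"
    if "mset (concat L) = replicate_mset (r - i) 0 + mset_set {1..i}" for L :: "nat list list"
  proof -
    have "size (mset (concat L)) = r" unfolding that using assms by simp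
    then show ?thesis by (simp add: length_concat)
  qed
  {
    fix z assume "z \<in> (\<lambda>L. (lattice_path (map length L), concat L)) ` labelled_columns r i"
    then show "z \<in> multi_labeled_dyck_paths r i"
      by (auto simp: labelled_columns_def multi_labeled_dyck_paths_def dyck_words_eq le len
        permutations_of_multiset_def length_concat take_map intro!: imageI)
  next
    fix z assume "z \<in> multi_labeled_dyck_paths r i"
    then obtain s xs where z: "z = (lattice_path s, xs)"
      and s: "length s = r" "sum_list s = r" "\<forall>m \<le> r. m \<le> sum_list (take m s)"
      and xs: "mset xs = replicate_mset (r - i) 0 + mset_set {1..i}"
      and lab: "labels_along (\<le>) (lattice_path s) xs"
      by (auto simp: multi_labeled_dyck_paths_def dyck_words_eq permutations_of_multiset_def)
    have "length xs = sum_list s"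
      using arg_cong[OF xs, of size] assms s by simp
    then obtain L where L: "concat L = xs" "map length L = s"
      by (rule ex_concat_map_length)
    have "L \<in> labelled_columns r i"
      using s xs lab le[of L] L
      by (auto simp: labelled_columns_def length_concat simp flip: take_map)
    then show "z \<in> (\<lambda>L. (lattice_path (map length L), concat L)) ` labelled_columns r i"
      using L z by (intro image_eqI) auto
  }
qed

subsection \<open>Gravity diagrams as flows\<close>

text \<open>The image of a class under \<open>f\<close> is a singleton, from which
  \<open>the_elem\<close> extracts the common value; distinct classes have distinct values.\<close>

lemma bij_betw_quotient_kernel:
  assumes "R = {(x, y). x \<in> A \<and> y \<in> A \<and> f x = f y}"
  shows "bij_betw (\<lambda>X. the_elem (f ` X)) (A // R) (f ` A)"
proof -
  have the: "the_elem (f ` (R `` {x})) = f x" if "x \<in> A" for x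
  proof -
    have "f ` (R `` {x}) = {f x}" using that by (auto simp: assms)
    then show ?thesis by simp
  qed
  show ?thesis
    unfolding bij_betw_def
  proof
    show "inj_on (\<lambda>X. the_elem (f ` X)) (A // R)"
      by (rule inj_onI) (auto simp: quotient_def the, auto simp: assms)
    show "(\<lambda>X. the_elem (f ` X)) ` (A // R) = f ` A"
      by (auto simp: quotient_def the image_iff)
  qed
qed

text \<open>A line through column \<open>k\<close> has exactly one dot there, and every dot lies on
  exactly one line, so these lines correspond to the dots of the column.\<close>

lemma blocks_meeting_column:
  assumes P: "P \<in> line_dot_diagrams H n v" and k: "k \<in> {1..<n}"
  shows "finite {B \<in> P. k \<in> fst ` B}" "card {B \<in> P. k \<in> fst ` B} = nat (root_coeff v k)"
proof -
  have part: "partition_on (dot_array n v) P" and lines: "\<And>B. B \<in> P \<Longrightarrow> inj_on fst B"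
    using P by (auto simp: line_dot_diagrams_def is_line_def)
  \<comment> \<open>\<open>inv_into B fst k\<close> selects the dot of \<open>B\<close> in column
    \<open>k\<close>.\<close>
  have in_B: "inv_into B fst k \<in> B" "fst (inv_into B fst k) = k" if "k \<in> fst ` B" for B :: "(nat \<times> nat) set"
    using that by (rule inv_into_into f_inv_into_f)+
  have "bij_betw (\<lambda>B. inv_into B fst k) {B \<in> P. k \<in> fst ` B} ({k} \<times> {..<nat (root_coeff v k)})"
  proof (intro bij_betw_imageI inj_onI subset_antisym[OF image_subsetI subsetI])
    fix B C assume B: "B \<in> {B \<in> P. k \<in> fst ` B}" and C: "C \<in> {B \<in> P. k \<in> fst ` B}"
      and eq: "inv_into B fst k = inv_into C fst k"
    have "inv_into B fst k \<in> B" using B by (intro in_B) simp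
    moreover have "inv_into B fst k \<in> C" unfolding eq using C by (intro in_B) simp
    ultimately show "B = C"
      using B C disjointD[OF partition_onD2[OF part], of B C] by blast
  next
    fix B assume B: "B \<in> {B \<in> P. k \<in> fst ` B}"
    then have x: "inv_into B fst k \<in> B" "fst (inv_into B fst k) = k" by (auto intro!: in_B)
    moreover have "inv_into B fst k \<in> dot_array n v" using partition_onD1[OF part] B x(1) by blast
    ultimately show "inv_into B fst k \<in> {k} \<times> {..<nat (root_coeff v k)}"
      by (cases "inv_into B fst k") (auto simp: dot_array_def)
  next
    fix x assume x: "x \<in> {k} \<times> {..<nat (root_coeff v k)}"
    then have "x \<in> dot_array n v" using k by (auto simp: dot_array_def)
    then obtain B where B: "B \<in> P" "x \<in> B" using partition_onD1[OF part] by blast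
    moreover have "k \<in> fst ` B" using x B(2) by (intro image_eqI[of _ _ x]) auto
    moreover have "inv_into B fst k = x" using x B lines by (auto intro: inv_into_f_eq)
    ultimately show "x \<in> (\<lambda>B. inv_into B fst k) ` {B \<in> P. k \<in> fst ` B}"
      by (intro image_eqI[of _ _ B]) simp_all
  qed
  from bij_betw_finite[OF this] bij_betw_same_card[OF this]
  show "finite {B \<in> P. k \<in> fst ` B}" "card {B \<in> P. k \<in> fst ` B} = nat (root_coeff v k)"
    by simp_all
qed

text \<open>The lines through column \<open>k\<close> are grouped by their edges (p, q), which are
  those with p \<le> k < q.\<close>

lemma column_count:
  assumes P: "P \<in> line_dot_diagrams H n v" and k: "k \<in> {1..<n}" and H: "finite H"
  shows "nat (root_coeff v k) =
    (\<Sum>e \<in> {e \<in> H. fst e \<le> k \<and> k < snd e}. card {B \<in> P. is_line e B})"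
proof -
  let ?E = "{e \<in> H. fst e \<le> k \<and> k < snd e}"
  have union: "{B \<in> P. k \<in> fst ` B} = (\<Union>e \<in> ?E. {B \<in> P. is_line e B})"
  proof (intro equalityI subsetI)
    fix B assume B: "B \<in> {B \<in> P. k \<in> fst ` B}"
    then obtain e where "e \<in> H" "is_line e B" using P by (auto simp: line_dot_diagrams_def)
    moreover from this have "fst e \<le> k \<and> k < snd e" using B by (simp add: is_line_def)
    ultimately show "B \<in> (\<Union>e \<in> ?E. {B \<in> P. is_line e B})" using B by blast
  qed (auto simp: is_line_def)
  have "card (\<Union>e \<in> ?E. {B \<in> P. is_line e B}) = (\<Sum>e \<in> ?E. card {B \<in> P. is_line e B})"
  proof (rule card_UN_disjoint)
    show "finite ?E" using H by simp
    show "\<forall>e \<in> ?E. finite {B \<in> P. is_line e B}"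
    proof
      fix e assume "e \<in> ?E"
      then have "{B \<in> P. is_line e B} \<subseteq> {B \<in> P. k \<in> fst ` B}" by (simp add: is_line_def subset_iff)
      then show "finite {B \<in> P. is_line e B}"
        using blocks_meeting_column(1)[OF P k] by (rule finite_subset)
    qed
    show "\<forall>e \<in> ?E. \<forall>e' \<in> ?E. e \<noteq> e' \<longrightarrow> {B \<in> P. is_line e B} \<inter> {B \<in> P. is_line e' B} = {}"
    proof (intro ballI impI)
      fix e e' assume "e \<in> ?E" "e' \<in> ?E" "e \<noteq> e'"
      \<comment> \<open>Both intervals contain \<open>k\<close>, so they are nonempty and determine
        their endpoints.\<close>
      then have "{fst e..<snd e} \<noteq> {fst e'..<snd e'}"
        by (subst atLeastLessThan_eq_iff) (auto simp: prod_eq_iff)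
      then show "{B \<in> P. is_line e B} \<inter> {B \<in> P. is_line e' B} = {}"
        unfolding is_line_def by blast
    qed
  qed
  then show ?thesis
    using blocks_meeting_column(2)[OF P k] union by simp
qed

section \<open>Flows on the restricted caracol graph: a star at vertex 1 and a path from vertex
  2\<close>

definition star_path :: "nat \<Rightarrow> (nat \<times> nat) set" where
  "star_path n = {(1, q) | q. 2 \<le> q \<and> q \<le> n} \<union> {(k, k + 1) | k. 2 \<le> k \<and> k < n}"

lemma Restr_caracol: "Restr (caracol (r + 3)) {1..r + 2} = star_path (r + 2)"
proof -
  have "(p, q) \<in> Restr (caracol (r + 3)) {1..r + 2} \<longleftrightarrow> (p, q) \<in> star_path (r + 2)" for p q
    by (simp add: caracol_def star_path_def) arith
  then show ?thesis by (meson subrelI subset_antisym)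
qed

text \<open>The entry at index \<open>q - 2\<close> belongs to the edge (1, q). Only the star edges
  are recorded, since the column sizes determine the multiplicities of the others.\<close>

definition star_flow :: "nat \<Rightarrow> (nat \<times> nat) set set \<Rightarrow> nat list" where
  "star_flow n P = map (\<lambda>q. card {B \<in> P. is_line (1, q) B}) [2..<Suc n]"

text \<open>The sum of \<open>drop (k - 1) b\<close> counts the star lines that reach column
  \<open>k\<close>, those with q > k. They fill column 1 exactly, as only star edges leave vertex 1;
  in later columns dots may be left over.\<close>

definition star_flows :: "nat \<Rightarrow> int list \<Rightarrow> nat list set" where
  "star_flows n v = {b. length b = n - 1 \<and> int (sum_list b) = root_coeff v 1 \<and>
     (\<forall>k \<in> {1..<n}. int (sum_list (drop (k - 1) b)) \<le> root_coeff v k)}"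

text \<open>Column \<open>k\<close> is crossed by the edges (1, q) with q > k and by (k, k + 1). For
  \<open>k = 1\<close> the latter is itself a star edge and must not be counted twice.\<close>

lemma column_count_star_path:
  assumes P: "P \<in> line_dot_diagrams (star_path n) n v" and k: "k \<in> {1..<n}"
  shows "nat (root_coeff v k) = sum_list (drop (k - 1) (star_flow n P)) +
    (if k = 1 then 0 else card {B \<in> P. is_line (k, k + 1) B})"
proof -
  have "star_path n \<subseteq> {..n} \<times> {..n}" by (auto simp: star_path_def)
  then have fin: "finite (star_path n)" by (rule finite_subset) simp
  have "{e \<in> star_path n. fst e \<le> k \<and> k < snd e} =
      Pair 1 ` {k + 1..n} \<union> (if k = 1 then {} else {(k, k + 1)})"
    using k by (auto simp: star_path_def)
  then have "nat (root_coeff v k) =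
      (\<Sum>e \<in> Pair 1 ` {k + 1..n} \<union> (if k = 1 then {} else {(k, k + 1)}).
         card {B \<in> P. is_line e B})"
    using column_count[OF P k fin] by simp
  also have "\<dots> = (\<Sum>e \<in> Pair 1 ` {k + 1..n}. card {B \<in> P. is_line e B}) +
      (if k = 1 then 0 else card {B \<in> P. is_line (k, k + 1) B})"
    by (subst sum.union_disjoint) auto
  also have "(\<Sum>e \<in> Pair 1 ` {k + 1..n}. card {B \<in> P. is_line e B}) =
      (\<Sum>q = k + 1..n. card {B \<in> P. is_line (1, q) B})"
    by (subst sum.reindex) (auto simp: inj_on_def)
  also have "\<dots> = sum_list (drop (k - 1) (star_flow n P))"
  proof -
    \<comment> \<open>The flow list starts at q = 2, so dropping \<open>k - 1\<close> entries makes
      it start at q = k + 1.\<close>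
    have "2 + (k - 1) = k + 1" using k by auto
    then have "drop (k - 1) (star_flow n P) = map (\<lambda>q. card {B \<in> P. is_line (1, q) B}) [k + 1..<Suc n]"
      by (simp only: star_flow_def drop_map drop_upt)
    moreover have "{k + 1..n} = set [k + 1..<Suc n]" by auto
    ultimately show ?thesis
      by (simp only: sum_set_upt_conv_sum_list_nat)
  qed
  finally show ?thesis .
qed

text \<open>By \<open>column_count_star_path\<close> the multiplicity of (k, k + 1) for k \<ge> 2 is
  the size of column \<open>k\<close> minus the star lines reaching it. Equivalence is thus the
  kernel of \<open>star_flow\<close>, the form that \<open>bij_betw_quotient_kernel\<close>
  expects.\<close>

lemma line_dot_equiv_star_path:
  "line_dot_equiv (star_path n) n v = {(P, Q). P \<in> line_dot_diagrams (star_path n) n v \<and>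
     Q \<in> line_dot_diagrams (star_path n) n v \<and> star_flow n P = star_flow n Q}"
proof -
  have "(\<forall>e \<in> star_path n. card {B \<in> P. is_line e B} = card {B \<in> Q. is_line e B}) \<longleftrightarrow>
      star_flow n P = star_flow n Q"
    if P: "P \<in> line_dot_diagrams (star_path n) n v" and Q: "Q \<in> line_dot_diagrams (star_path n) n v"
    for P Q
  proof
    assume "\<forall>e \<in> star_path n. card {B \<in> P. is_line e B} = card {B \<in> Q. is_line e B}"
    then show "star_flow n P = star_flow n Q"
      by (auto simp: star_flow_def star_path_def)
  next
    assume eq: "star_flow n P = star_flow n Q"
    show "\<forall>e \<in> star_path n. card {B \<in> P. is_line e B} = card {B \<in> Q. is_line e B}"
    proof
      fix e assume "e \<in> star_path n"
      then consider q where "e = (1, q)" "q \<in> set [2..<Suc n]" | k where "e = (k, k + 1)" "2 \<le> k" "k < n"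
        by (auto simp: star_path_def simp del: upt_Suc)
      then show "card {B \<in> P. is_line e B} = card {B \<in> Q. is_line e B}"
      proof cases
        case 1
        then show ?thesis using eq unfolding star_flow_def map_eq_conv by blast
      next
        case 2
        then show ?thesis
          using column_count_star_path[OF P, of k] column_count_star_path[OF Q, of k] eq by simp
      qed
    qed
  qed
  then show ?thesis by (auto simp: line_dot_equiv_def)
qed

lemma star_flow_mem:
  assumes "n \<ge> 2" and P: "P \<in> line_dot_diagrams (star_path n) n v"
  shows "star_flow n P \<in> star_flows n v"
proof -
  have nonneg: "0 \<le> root_coeff v k" if "k \<in> {1..<n}" for k
    using P that by (auto simp: line_dot_diagrams_def)
  have "int (sum_list (star_flow n P)) = root_coeff v 1"
    using column_count_star_path[OF P, of 1] nonneg[of 1] assms(1) by simp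
  moreover have "int (sum_list (drop (k - 1) (star_flow n P))) \<le> root_coeff v k"
    if "k \<in> {1..<n}" for k
    using column_count_star_path[OF P that] nonneg[OF that] by simp
  ultimately show ?thesis by (simp add: star_flows_def star_flow_def del: upt_Suc)
qed

lemma sum_list_drop_antimono:
  fixes b :: "nat list"
  assumes "i \<le> j"
  shows "sum_list (drop j b) \<le> sum_list (drop i b)"
proof -
  obtain d where "j = d + i" using assms by (metis le_Suc_ex add.commute)
  then have "drop j b = drop d (drop i b)" by simp
  then show ?thesis
    by (metis append_take_drop_id le_add2 sum_list_append)
qed

text \<open>The star lines are drawn as horizontal rows starting in column 1, the longer ones below,
  and every dot above them becomes a line of its own.\<close>

lemma ex_line_dot_diagram:
  assumes n: "n \<ge> 2" and b: "b \<in> star_flows n v"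
  obtains P where "P \<in> line_dot_diagrams (star_path n) n v" "star_flow n P = b"
proof -
  \<comment> \<open>\<open>c k\<close> is the number of star lines that have to meet column
    \<open>k\<close>; it decreases weakly with \<open>k\<close>.\<close>
  define c where "c k = sum_list (drop (k - 1) b)" for k
  have len: "length b = n - 1" and c1: "int (c 1) = root_coeff v 1"
    and c_le: "\<And>k. k \<in> {1..<n} \<Longrightarrow> int (c k) \<le> root_coeff v k"
    using b by (auto simp: star_flows_def c_def)
  have c_step: "c k = b ! (k - 1) + c (k + 1)" if "1 \<le> k" "k < n" for k
    using that len Cons_nth_drop_Suc[of "k - 1" b] by (auto simp: c_def simp flip: sum_list.Cons)
  have cn: "c n = 0" by (simp add: c_def len)
  have antimono: "c k' \<le> c k" if "k \<le> k'" for k k'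
    unfolding c_def using that by (intro sum_list_drop_antimono) simp
  define line where "line j = {k \<in> {1..<n}. j < c k} \<times> {j}" for j
  \<comment> \<open>The dots left over by the rows. Column 1 contains none, since \<open>c 1\<close>
    is its full size.\<close>
  define S where "S = {(k, j). k \<in> {1..<n} \<and> c k \<le> j \<and> int j < root_coeff v k}"
  define P where "P = line ` {..<c 1} \<union> (\<lambda>x. {x}) ` S"
  have fst_line: "fst ` line j = {k \<in> {1..<n}. j < c k}" for j
    by (auto simp: line_def image_iff)
  have inj_line: "inj_on fst (line j)" for j
    by (auto simp: line_def inj_on_def)
  have mem1: "(1, j) \<in> line j" if "j < c 1" for j
    using that n by (auto simp: line_def)
  have is_line_line: "\<exists>e \<in> star_path n. is_line e (line j)" if "j < c 1" for j
  proof -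
    \<comment> \<open>The columns met by row \<open>j\<close> form an initial interval because
      \<open>c\<close> is decreasing, so the row belongs to the edge from 1 to
      \<open>Suc (Max K)\<close>.\<close>
    define K where "K = {k \<in> {1..<n}. j < c k}"
    have "finite K" "1 \<in> K" using that n by (simp_all add: K_def)
    then have "Max K \<in> K" and le_Max: "\<And>k. k \<in> K \<Longrightarrow> k \<le> Max K" by (auto intro: Max_in)
    then have Max: "1 \<le> Max K" "Max K < n" "j < c (Max K)" by (simp_all add: K_def)
    have "K = {1..<Suc (Max K)}"
    proof (intro equalityI subsetI)
      fix k assume k: "k \<in> {1..<Suc (Max K)}"
      then have "c (Max K) \<le> c k" by (intro antimono) simp
      then show "k \<in> K" using k Max by (simp add: K_def)
    next
      fix k assume k: "k \<in> K"
      then have "1 \<le> k" by (simp add: K_def)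
      with le_Max[OF k] show "k \<in> {1..<Suc (Max K)}" by simp
    qed
    then have "fst ` line j = {1..<Suc (Max K)}"
      by (rule trans[OF trans[OF fst_line K_def[symmetric]]])
    then have "is_line (1, Suc (Max K)) (line j)"
      by (simp add: is_line_def inj_line)
    moreover have "(1, Suc (Max K)) \<in> star_path n"
      using Max unfolding star_path_def by simp
    ultimately show ?thesis by blast
  qed
  have is_line_single: "\<exists>e \<in> star_path n. is_line e {x}" if "x \<in> S" for x
  proof -
    from that obtain k j where x: "x = (k, j)" "k \<in> {1..<n}" by (auto simp: S_def)
    then have "(k, k + 1) \<in> star_path n"
      by (auto simp: star_path_def)
    moreover have "is_line (k, k + 1) {x}" using x by (auto simp: is_line_def)
    ultimately show ?thesis by blast
  qed
  have c_le1: "j < c 1" if "j < c k" "k \<in> {1..<n}" for j k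
    using antimono[of 1 k] that by auto
  have "partition_on (dot_array n v) P"
  proof (rule partition_onI)
    show "\<Union> P = dot_array n v"
    proof (intro equalityI subsetI)
      fix x assume "x \<in> \<Union> P"
      then show "x \<in> dot_array n v"
        using c_le by (fastforce simp: P_def line_def S_def dot_array_def)
    next
      fix x assume "x \<in> dot_array n v"
      then obtain k j where x: "x = (k, j)" "k \<in> {1..<n}" "int j < root_coeff v k"
        by (auto simp: dot_array_def)
      show "x \<in> \<Union> P"
      proof (cases "j < c k")
        case True
        then have "x \<in> line j" "j < c 1" using x c_le1 by (auto simp: line_def)
        then show ?thesis by (auto simp: P_def)
      next
        case False
        then have "x \<in> S" using x by (auto simp: S_def)
        then show ?thesis by (auto simp: P_def)
      qed
    qed
    have "line j \<noteq> {}" if "j < c 1" for j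
      using mem1[OF that] by blast
    then show "{} \<notin> P"
      by (auto simp: P_def)
    show "disjnt p q" if "p \<in> P" "q \<in> P" "p \<noteq> q" for p q
      using that by (auto simp: P_def line_def S_def disjnt_def)
  qed
  moreover have "\<forall>k \<in> {1..<n}. 0 \<le> root_coeff v k"
    using c_le by (meson of_nat_0_le_iff order_trans)
  ultimately have mem: "P \<in> line_dot_diagrams (star_path n) n v"
    using is_line_line is_line_single by (auto simp: line_dot_diagrams_def P_def)
  have card: "card {B \<in> P. is_line (1, q) B} = b ! (q - 2)" if q: "2 \<le> q" "q \<le> n" for q
  proof -
    \<comment> \<open>Row \<open>j\<close> ends in column \<open>q - 1\<close> exactly when it
      reaches that column but not column \<open>q\<close>. For \<open>q = n\<close> there is no such
      column, and \<open>c n = 0\<close> gives the lower bound.\<close>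
    have iff: "{k \<in> {1..<n}. j < c k} = {1..<q} \<longleftrightarrow> j \<in> {c q..<c (q - 1)}" for j
    proof
      assume eq: "{k \<in> {1..<n}. j < c k} = {1..<q}"
      have "q - 1 \<in> {1..<q}" using q by auto
      moreover have "q \<notin> {k \<in> {1..<n}. j < c k}" unfolding eq by simp
      ultimately show "j \<in> {c q..<c (q - 1)}"
        using q cn unfolding eq[symmetric] by (cases "q = n") auto
    next
      assume j: "j \<in> {c q..<c (q - 1)}"
      have less_iff: "j < c k \<longleftrightarrow> k < q" for k
      proof (cases "k < q")
        case True
        then have "c (q - 1) \<le> c k" by (intro antimono) simp
        with True j show ?thesis by simp
      next
        case False
        with j antimono[of q k] show ?thesis by simp
      qed
      show "{k \<in> {1..<n}. j < c k} = {1..<q}" unfolding less_iff using q by auto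
    qed
    have "{B \<in> P. is_line (1, q) B} = line ` {c q..<c (q - 1)}"
    proof (intro equalityI subsetI)
      fix B assume B: "B \<in> {B \<in> P. is_line (1, q) B}"
      then consider j where "B = line j" | x where "B = {x}" "x \<in> S"
        by (auto simp: P_def)
      then show "B \<in> line ` {c q..<c (q - 1)}"
      proof cases
        case 1
        then show ?thesis using B iff by (auto simp: is_line_def fst_line)
      next
        case 2
        \<comment> \<open>A single dot assigned to a star edge would lie in column 1, where
          \<open>S\<close> is empty.\<close>
        then have "{fst x} = {1..<q}" using B by (simp add: is_line_def)
        moreover have "1 \<in> {1..<q}" using q by simp
        ultimately have "1 \<in> {fst x}" by (simp only:)
        then show ?thesis using 2(2) c1 by (auto simp: S_def)
      qed
    next
      fix B assume "B \<in> line ` {c q..<c (q - 1)}"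
      then obtain j where j: "B = line j" "j \<in> {c q..<c (q - 1)}" by blast
      have "c (q - 1) \<le> c 1" using q by (intro antimono) auto
      then show "B \<in> {B \<in> P. is_line (1, q) B}"
        using j iff[of j] by (auto simp: P_def is_line_def fst_line inj_line)
    qed
    \<comment> \<open>Rows are told apart by their dots in column 1.\<close>
    moreover have "inj_on line {c q..<c (q - 1)}"
    proof (rule inj_onI)
      fix j j' assume "j \<in> {c q..<c (q - 1)}" "line j = line j'"
      moreover have "c (q - 1) \<le> c 1" using q by (intro antimono) auto
      ultimately show "j = j'" using mem1[of j] by (auto simp: line_def)
    qed
    ultimately have "card {B \<in> P. is_line (1, q) B} = c (q - 1) - c q"
      by (simp add: card_image)
    then show ?thesis using c_step[of "q - 1"] q by (simp add: numeral_2_eq_2)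
  qed
  have "star_flow n P = b"
    by (rule nth_equalityI) (use card len in \<open>auto simp: star_flow_def nth_upt simp del: upt_Suc\<close>)
  with mem show ?thesis using that by blast
qed

lemma bij_betw_gravity_diagrams_star_flows:
  assumes "n \<ge> 2"
  shows "bij_betw (\<lambda>D. the_elem (star_flow n ` D)) (gravity_diagrams (star_path n) n v)
    (star_flows n v)"
proof -
  have "star_flow n ` line_dot_diagrams (star_path n) n v = star_flows n v"
    using star_flow_mem[OF assms] ex_line_dot_diagram[OF assms] by blast
  then show ?thesis
    using bij_betw_quotient_kernel[OF line_dot_equiv_star_path, of n v]
    by (simp add: gravity_diagrams_def)
qed

subsection \<open>Refined unified diagrams as lists of labeled columns\<close>

lemma sum_list_take_map2_diff:
  assumes "length s = length t"
  shows "sum_list (take k (map2 (\<lambda>a b. int a - b) s t)) =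
    int (sum_list (take k s)) - sum_list (take k t)"
  using assms
proof (induction s t arbitrary: k rule: list_induct2)
  case Nil
  show ?case by simp
next
  case (Cons a s b t)
  then show ?case by (cases k) simp_all
qed

text \<open>Serves to discard the last column of a \<open>t\<close>-Dyck path, which is always empty
  at level \<open>i\<close> and contributes only a final East step.\<close>

lemma labels_along_append_East: "labels_along R (w @ [East]) xs \<longleftrightarrow> labels_along R w xs"
  unfolding labels_along_def
proof (rule all_cong1)
  fix p
  show "(Suc p < length (w @ [East]) \<longrightarrow> (w @ [East]) ! p = North \<longrightarrow>
        (w @ [East]) ! Suc p = North \<longrightarrow>
        R (xs ! count_list (take p (w @ [East])) North)
          (xs ! count_list (take (Suc p) (w @ [East])) North)) \<longleftrightarrow>
      (Suc p < length w \<longrightarrow> w ! p = North \<longrightarrow> w ! Suc p = North \<longrightarrow>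
        R (xs ! count_list (take p w) North) (xs ! count_list (take (Suc p) w) North))"
    by (cases "Suc p < length w") (auto simp: nth_append)
qed

lemma lattice_path_append: "lattice_path (s @ s') = lattice_path s @ lattice_path s'"
  by (simp add: lattice_path_def)

text \<open>With first entry 2r - i, column m + 1 has (r - i) + (a_1 + ... + a_m) - m dots, and (r -
  i) - (b_1 + ... + b_m) star lines reach it. Comparing the two numbers gives the Dyck condition for
  the sums a_k + b_k.\<close>

lemma dyck_path_star_flow_iff:
  fixes r i :: nat and s b :: "nat list"
  defines "t \<equiv> int r # replicate r 1 @ [0]"
  assumes "i \<le> r"
  shows "s \<in> dyck_paths_of t \<and> int (s ! 0) = sum_list t - int i \<and>
      b \<in> star_flows (r + 2) (map2 (\<lambda>a b. int a - b) s t) \<longleftrightarrow>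
    (\<exists>a b'. s = (2 * r - i) # a @ [0] \<and> b = b' @ [0] \<and> length a = r \<and> length b' = r \<and>
      sum_list a = i \<and> sum_list b' = r - i \<and>
      (\<forall>m \<le> r. m \<le> sum_list (take m a) + sum_list (take m b')))"
    (is "?lhs \<longleftrightarrow> ?rhs")
proof -
  let ?v = "map2 (\<lambda>a b. int a - b) s t"
  have len_t: "length t = r + 2" and sum_t: "sum_list t = 2 * int r"
    by (simp_all add: t_def sum_list_replicate)
  have take_t: "sum_list (take (Suc m) t) = int r + int m" if "m \<le> r" for m
    using that by (simp add: t_def sum_list_replicate)
  have root: "root_coeff ?v (Suc m) = int x + int (sum_list (take m a)) - int r - int m"
    if "s = x # a @ [y]" "length a = r" "m \<le> r" for x a y m
  proof -
    have "length s = length t" using that by (simp add: len_t)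
    then have "root_coeff ?v (Suc m) = int (sum_list (take (Suc m) s)) - sum_list (take (Suc m) t)"
      unfolding root_coeff_def by (rule sum_list_take_map2_diff)
    then show ?thesis using that by (simp add: take_t)
  qed
  have drop_sum: "sum_list (take m c) + sum_list (drop m c) = sum_list c" for m and c :: "nat list"
    by (metis append_take_drop_id sum_list_append)
  show ?thesis
  proof
    assume ?lhs
    then have len: "length s = r + 2" and sum: "int (sum_list s) = 2 * int r"
      and dyck: "\<And>k. k \<le> r + 2 \<Longrightarrow> sum_list (take k t) \<le> int (sum_list (take k s))"
      and s0: "int (s ! 0) = 2 * int r - int i"
      and b: "length b = r + 1" "int (sum_list b) = root_coeff ?v 1"
        "\<And>k. k \<in> {1..<r + 2} \<Longrightarrow> int (sum_list (drop (k - 1) b)) \<le> root_coeff ?v k"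
      by (auto simp: dyck_paths_of_def len_t sum_t star_flows_def)
    obtain x a y where s: "s = x # a @ [y]" and len_a: "length a = r"
    proof -
      obtain x u where "s = x # u" "length u = Suc r" using len by (cases s) auto
      moreover from this obtain a y where "u = a @ [y]" by (cases u rule: rev_cases) auto
      ultimately show ?thesis using that by simp
    qed
    obtain b' z where b': "b = b' @ [z]" and len_b': "length b' = r"
      using b(1) by (cases b rule: rev_cases) auto
    have x: "x = 2 * r - i" using s0 s by simp
    \<comment> \<open>After r + 1 entries \<open>t\<close> has reached its total 2r, so
      \<open>s\<close> has too, and nothing remains for its last entry.\<close>
    have "int r + int r \<le> int x + int (sum_list a)"
      using dyck[of "Suc r"] take_t[of r] s len_a by simp
    then have y: "y = 0" and sum_a: "sum_list a = i"
      using sum s x assms(2) by simp_all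
    \<comment> \<open>\<open>z\<close> counts the lines of the edge (1, r + 2), which would all meet
      column r + 1; that column is empty.\<close>
    have "int z \<le> root_coeff ?v (Suc r)"
      using b(3)[of "Suc r"] b' len_b' by simp
    then have z: "z = 0"
      using root[OF s len_a, of r] x sum_a len_a assms(2) by simp
    have sum_b': "sum_list b' = r - i"
      using b(2) root[OF s len_a, of 0] b' z x assms(2) by simp
    have "m \<le> sum_list (take m a) + sum_list (take m b')" if "m \<le> r" for m
    proof -
      have "int (sum_list (drop m b')) \<le> root_coeff ?v (Suc m)"
        using b(3)[of "Suc m"] that b' z len_b' by simp
      then show ?thesis
        using root[OF s len_a that] x sum_b' drop_sum[of m b'] assms(2) by simp
    qed
    then show ?rhs
      using s x y b' z len_a len_b' sum_a sum_b' by blast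
  next
    assume ?rhs
    then obtain a b' where s: "s = (2 * r - i) # a @ [0]" and b: "b = b' @ [0]"
      and len_a: "length a = r" and len_b': "length b' = r"
      and sum_a: "sum_list a = i" and sum_b': "sum_list b' = r - i"
      and ballot: "\<And>m. m \<le> r \<Longrightarrow> m \<le> sum_list (take m a) + sum_list (take m b')"
      by blast
    have flow: "int (sum_list (drop m b')) \<le> root_coeff ?v (Suc m)" if "m \<le> r" for m
      using root[OF s len_a that] ballot[OF that] drop_sum[of m b'] sum_b' assms(2) by simp
    have "sum_list (take k t) \<le> int (sum_list (take k s))" if k: "k \<le> r + 2" for k
    proof -
      consider "k = 0" | m where "k = Suc m" "m \<le> r" | "k = r + 2"
        using k by (metis add_2_eq_Suc' le_SucE le_Suc_eq not0_implies_Suc Suc_le_mono)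
      then show ?thesis
      proof cases
        case 1
        then show ?thesis by simp
      next
        case 2
        \<comment> \<open>The \<open>t\<close>-Dyck inequality says that column \<open>k\<close> has
          nonnegative size, which follows from the number of star lines being a lower bound for
          it.\<close>
        then have "0 \<le> root_coeff ?v k" using flow[of m] by simp
        moreover have "length s = length t" by (simp add: s len_a len_t)
        ultimately show ?thesis by (simp add: root_coeff_def sum_list_take_map2_diff)
      next
        case 3
        then show ?thesis using assms(2) by (simp add: len_t sum_t s len_a sum_a)
      qed
    qed
    then have "s \<in> dyck_paths_of t"
      using assms(2) by (simp add: dyck_paths_of_def len_t sum_t s len_a sum_a)
    moreover have "b \<in> star_flows (r + 2) ?v"
    proof -
      have "int (sum_list (drop (k - 1) b)) \<le> root_coeff ?v k" if "k \<in> {1..<r + 2}" for k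
      proof -
        obtain m where "k = Suc m" "m \<le> r" using \<open>k \<in> _\<close> by (cases k) auto
        with flow[of m] show ?thesis by (simp add: b len_b')
      qed
      moreover have "int (sum_list b) = root_coeff ?v 1"
        using root[OF s len_a, of 0] sum_b' assms(2) by (simp add: b)
      ultimately show ?thesis by (simp add: star_flows_def b len_b')
    qed
    moreover have "int (s ! 0) = sum_list t - int i"
      using assms(2) by (simp add: s sum_t)
    ultimately show ?lhs by blast
  qed
qed

text \<open>Refined unified diagrams with the gravity diagram replaced by its star flow. The entries
  forced by \<open>dyck_path_star_flow_iff\<close> are kept, so that the first component is still
  the full \<open>t\<close>-Dyck path.\<close>

definition flow_diagrams :: "nat \<Rightarrow> nat \<Rightarrow> (nat list \<times> nat list \<times> nat list) set" where
  "flow_diagrams r i = {((2 * r - i) # a @ [0], \<sigma>, b @ [0]) | a \<sigma> b.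
     length a = r \<and> length b = r \<and> sum_list a = i \<and> sum_list b = r - i \<and>
     (\<forall>m \<le> r. m \<le> sum_list (take m a) + sum_list (take m b)) \<and>
     \<sigma> \<in> permutations_of_set {1..i} \<and> labels_along (<) (lattice_path a) \<sigma>}"

text \<open>The path and the permutation stay fixed while \<open>star_flow\<close> acts on the
  gravity diagrams over each path, so the bijections on the fibres combine.\<close>

lemma bij_betw_refined_unified_flow:
  assumes "i \<le> r"
  shows "bij_betw (\<lambda>(s, \<sigma>, D). (s, \<sigma>, the_elem (star_flow (r + 2) ` D)))
    (refined_unified_diagrams (caracol (r + 3)) (r + 2) i) (flow_diagrams r i)"
proof -
  define t where "t = int r # replicate r 1 @ [0]"
  define A where "A = {(s, \<sigma>). s \<in> dyck_paths_of t \<and> int (s ! 0) = sum_list t - int i \<and>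
    \<sigma> \<in> permutations_of_set {1..i} \<and> labels_along (<) (lattice_path (tl s)) \<sigma>}"
  define V where "V s = map2 (\<lambda>a b. int a - b) s t" for s :: "nat list"
  define f where "f D = the_elem (star_flow (r + 2) ` D)" for D
  have "bij_betw f (gravity_diagrams (star_path (r + 2)) (r + 2) v) (star_flows (r + 2) v)" for v
    unfolding f_def by (rule bij_betw_gravity_diagrams_star_flows) simp
  then have inj: "inj_on f (gravity_diagrams (star_path (r + 2)) (r + 2) v)"
    and img: "f ` gravity_diagrams (star_path (r + 2)) (r + 2) v = star_flows (r + 2) v" for v
    by (auto simp: bij_betw_def)
  have dom: "refined_unified_diagrams (caracol (r + 3)) (r + 2) i =
      {(s, \<sigma>, D). (s, \<sigma>) \<in> A \<and> D \<in> gravity_diagrams (star_path (r + 2)) (r + 2) (V s)}"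
    unfolding refined_unified_diagrams_def Let_def shifted_outdegrees_caracol Restr_caracol
      A_def V_def t_def by auto
  have "(s, \<sigma>, b) \<in> flow_diagrams r i \<longleftrightarrow> (s, \<sigma>) \<in> A \<and> b \<in> star_flows (r + 2) (V s)" for s \<sigma> b
  proof -
    have lab: "labels_along (<) (lattice_path (tl ((2 * r - i) # a @ [0]))) \<sigma> \<longleftrightarrow>
        labels_along (<) (lattice_path a) \<sigma>" for a
      by (simp add: lattice_path_append labels_along_append_East)
    have "(s, \<sigma>) \<in> A \<and> b \<in> star_flows (r + 2) (V s) \<longleftrightarrow>
        (s \<in> dyck_paths_of t \<and> int (s ! 0) = sum_list t - int i \<and> b \<in> star_flows (r + 2) (V s)) \<and>
        \<sigma> \<in> permutations_of_set {1..i} \<and> labels_along (<) (lattice_path (tl s)) \<sigma>"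
      unfolding A_def by blast
    also have "\<dots> \<longleftrightarrow> (s, \<sigma>, b) \<in> flow_diagrams r i"
      unfolding V_def t_def dyck_path_star_flow_iff[OF assms] flow_diagrams_def
      using lab by blast
    finally show ?thesis by blast
  qed
  then have cod: "flow_diagrams r i = {(s, \<sigma>, b). (s, \<sigma>) \<in> A \<and> b \<in> f `
      gravity_diagrams (star_path (r + 2)) (r + 2) (V s)}"
    unfolding img by auto
  show ?thesis
    unfolding dom cod f_def[symmetric]
  proof (rule bij_betw_imageI)
    show "inj_on (\<lambda>(s, \<sigma>, D). (s, \<sigma>, f D))
      {(s, \<sigma>, D). (s, \<sigma>) \<in> A \<and> D \<in> gravity_diagrams (star_path (r + 2)) (r + 2) (V s)}"
      by (rule inj_onI) (auto dest: inj_onD[OF inj])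
  qed (fastforce simp: image_iff)
qed

section \<open>Separating the zeros from the positive labels\<close>

lemma sorted_eq_zeros_append:
  fixes c :: "nat list"
  assumes "sorted c"
  shows "c = replicate (count_list c 0) 0 @ filter ((<) 0) c"
  using assms
proof (induction c)
  case Nil
  show ?case by simp
next
  case (Cons x c)
  show ?case
  proof (cases "x = 0")
    case True
    then show ?thesis using Cons by simp
  next
    case False
    then have "\<forall>y \<in> set (x # c). 0 < y" using Cons.prems by auto
    then have "filter ((<) 0) (x # c) = x # c" "count_list (x # c) 0 = 0"
      by (simp_all only: filter_id_conv count_list_0_iff) blast
    then show ?thesis by simp
  qed
qed

definition positive_labels :: "nat list \<Rightarrow> nat list" where
  "positive_labels = filter ((<) 0)"

text \<open>The positive labels of the columns give the path and the permutation, and the numbers of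
  zeros give the star flow.\<close>

definition split_columns :: "nat \<Rightarrow> nat \<Rightarrow> nat list list \<Rightarrow> nat list \<times> nat list \<times> nat list" where
  "split_columns r i L = ((2 * r - i) # map length (map positive_labels L) @ [0],
     concat (map positive_labels L), map (\<lambda>c. count_list c 0) L @ [0])"

lemma mset_concat_positive_labels:
  "mset (concat L) = replicate_mset (sum_list (map (\<lambda>c. count_list c 0) L)) 0 +
     mset (concat (map positive_labels L))"
proof -
  have column: "mset c = replicate_mset (count_list c 0) 0 + mset (positive_labels c)" for c
    by (induction c) (auto simp: positive_labels_def)
  have add: "replicate_mset (m + n) x = replicate_mset m x + replicate_mset n x"
    for m n and x :: nat
    by (induction m) simp_all
  show ?thesis
  proof (induction L)
    case (Cons c L)
    with column[of c] show ?case by (simp add: add del: mset_concat)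
  qed simp
qed

text \<open>Applied to the first \<open>m\<close> columns, this identifies the Dyck condition of
  \<open>labelled_columns\<close> with that of \<open>flow_diagrams\<close>.\<close>

lemma length_concat_positive_labels:
  "length (concat L) =
     sum_list (map length (map positive_labels L)) + sum_list (map (\<lambda>c. count_list c 0) L)"
  using arg_cong[OF mset_concat_positive_labels[of L], of size]
  by (simp add: length_concat comp_def)

text \<open>In a sorted column the zeros come first, so their number and the list of positive labels
  determine the column, and any such pair with increasing positive labels occurs.\<close>

lemma bij_betw_labelled_columns_flow:
  assumes "i \<le> r"
  shows "bij_betw (split_columns r i) (labelled_columns r i) (flow_diagrams r i)"
proof (intro bij_betw_imageI inj_onI subset_antisym[OF image_subsetI subsetI])
  fix L L' assume L: "L \<in> labelled_columns r i" and L': "L' \<in> labelled_columns r i"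
    and "split_columns r i L = split_columns r i L'"
  then have "concat (map positive_labels L) = concat (map positive_labels L')"
    "map length (map positive_labels L) = map length (map positive_labels L')"
    and zeros: "map (\<lambda>c. count_list c 0) L = map (\<lambda>c. count_list c 0) L'"
    unfolding split_columns_def by simp_all
  then have pos: "map positive_labels L = map positive_labels L'"
    by (intro concat_map_length_inject)
  have rebuild: "map2 (\<lambda>z c. replicate z 0 @ c) (map (\<lambda>c. count_list c 0) M)
      (map positive_labels M) = M" if "M \<in> labelled_columns r i" for M
  proof -
    have "replicate (count_list c 0) 0 @ positive_labels c = c" if "c \<in> set M" for c
      using sorted_eq_zeros_append[of c] that \<open>M \<in> labelled_columns r i\<close>
      by (simp add: labelled_columns_def positive_labels_def)
    then have "map (\<lambda>c. replicate (count_list c 0) 0 @ positive_labels c) M = M"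
      by (rule map_idI)
    then show ?thesis by (simp add: zip_map_map zip_same_conv_map comp_def)
  qed
  show "L = L'"
    using rebuild[OF L] rebuild[OF L'] unfolding pos zeros by simp
next
  fix L assume "L \<in> labelled_columns r i"
  then have len: "length L = r" and sorted: "\<And>c. c \<in> set L \<Longrightarrow> sorted c"
    and mset: "mset (concat L) = replicate_mset (r - i) 0 + mset_set {1..i}"
    and prefix: "\<And>m. m \<le> r \<Longrightarrow> m \<le> length (concat (take m L))"
    by (auto simp: labelled_columns_def)
  define C where "C = map positive_labels L"
  define b where "b = map (\<lambda>c. count_list c 0) L"
  have eq: "replicate_mset (sum_list b) 0 + mset (concat C) =
      replicate_mset (r - i) 0 + mset_set {1..i}"
    using mset mset_concat_positive_labels[of L] unfolding C_def b_def by simp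
  \<comment> \<open>Comparing the multiplicity of 0 on both sides of \<open>eq\<close> yields the
    total r - i, and cancelling the zeros leaves a permutation of 1, ..., i.\<close>
  have "0 \<notin># mset (concat C)" by (auto simp: C_def positive_labels_def)
  then have "count (mset (concat C)) 0 = 0" by (simp only: not_in_iff)
  with arg_cong[OF eq, of "\<lambda>M. count M 0"] have sum_b: "sum_list b = r - i"
    by (simp del: count_mset_0_iff)
  with eq have mset_C: "mset (concat C) = mset_set {1..i}" by simp
  then have perm: "concat C \<in> permutations_of_set {1..i}"
    by (simp add: permutations_of_set_altdef permutations_of_multiset_def)
  then have "distinct (concat C)" by (simp add: permutations_of_set_def)
  \<comment> \<open>Each positive label occurs once, so non-decreasing columns become strictly
    increasing.\<close>
  have "sorted_wrt (<) c" if "c \<in> set C" for c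
  proof -
    have "sorted c" using that sorted by (auto simp: C_def positive_labels_def sorted_wrt_filter)
    moreover have "distinct c" using that \<open>distinct (concat C)\<close> by (simp add: distinct_concat_iff)
    ultimately show ?thesis by (simp add: strict_sorted_iff)
  qed
  then have lab: "labels_along (<) (lattice_path (map length C)) (concat C)"
    by (subst labels_along_concat) simp_all
  have "sum_list (map length C) = i"
    using arg_cong[OF mset_C, of size] by (simp add: length_concat)
  moreover have "m \<le> sum_list (take m (map length C)) + sum_list (take m b)" if "m \<le> r" for m
    using prefix[OF that] length_concat_positive_labels[of "take m L"]
    by (simp add: C_def b_def take_map)
  ultimately show "split_columns r i L \<in> flow_diagrams r i"
    unfolding flow_diagrams_def split_columns_def C_def[symmetric] b_def[symmetric]
    using len sum_b perm lab by (auto simp: C_def b_def)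
next
  fix z assume "z \<in> flow_diagrams r i"
  then obtain a \<sigma> b where z: "z = ((2 * r - i) # a @ [0], \<sigma>, b @ [0])"
    and len: "length a = r" "length b = r" and sum: "sum_list a = i" "sum_list b = r - i"
    and ballot: "\<And>m. m \<le> r \<Longrightarrow> m \<le> sum_list (take m a) + sum_list (take m b)"
    and perm: "\<sigma> \<in> permutations_of_set {1..i}" and lab: "labels_along (<) (lattice_path a) \<sigma>"
    unfolding flow_diagrams_def by blast
  have "length \<sigma> = sum_list a"
    using perm sum by (simp add: length_finite_permutations_of_set)
  then obtain C where C: "concat C = \<sigma>" "map length C = a" by (rule ex_concat_map_length)
  have len_C: "length C = r" using C(2) len by auto
  have pos: "0 < x" if "c \<in> set C" "x \<in> set c" for c x
  proof -
    have "x \<in> set \<sigma>" using that C(1) by auto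
    then show ?thesis using perm by (auto simp: permutations_of_set_def)
  qed
  have strict: "sorted_wrt (<) c" if "c \<in> set C" for c
    using that lab labels_along_concat[of "(<)" C] C by simp
  \<comment> \<open>The preimage puts b_m zeros below the positive labels of column
    \<open>m\<close>.\<close>
  define L where "L = map2 (\<lambda>z c. replicate z 0 @ c) b C"
  have column: "positive_labels (replicate k 0 @ c) = c" "count_list c 0 = 0"
    "sorted (replicate k 0 @ c)" if "c \<in> set C" for k c
  proof -
    show "positive_labels (replicate k 0 @ c) = c"
      using pos[OF that] by (auto simp: positive_labels_def filter_id_conv)
    show "count_list c 0 = 0"
      using pos[OF that] by (auto simp: count_list_0_iff)
    show "sorted (replicate k 0 @ c)"
      using strict[OF that] by (simp add: sorted_append strict_sorted_imp_sorted)
  qed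
  have L_pos: "map positive_labels L = C" and L_zeros: "map (\<lambda>c. count_list c 0) L = b"
    by (rule nth_equalityI; simp add: L_def len len_C column count_list_replicate)+
  have "sorted c" if "c \<in> set L" for c
    using that column(3) by (auto simp: L_def dest: set_zip_rightD)
  moreover have "length L = r" by (simp add: L_def len len_C)
  moreover have "mset (concat L) = replicate_mset (r - i) 0 + mset_set {1..i}"
    using mset_concat_positive_labels[of L] perm
    by (simp add: L_pos L_zeros C sum permutations_of_set_altdef permutations_of_multiset_def)
  moreover have "m \<le> length (concat (take m L))" if "m \<le> r" for m
    using ballot[OF that] length_concat_positive_labels[of "take m L"]
    unfolding take_map[symmetric] L_pos L_zeros C(2) by simp
  ultimately have "L \<in> labelled_columns r i"
    by (simp add: labelled_columns_def)
  moreover have "z = split_columns r i L"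
    unfolding split_columns_def L_pos L_zeros z C ..
  ultimately show "z \<in> split_columns r i ` labelled_columns r i" by blast
qed

theorem theorem5p6:
  fixes r i :: nat
  assumes "i \<le> r"
  shows "(\<exists>\<Phi>. bij_betw \<Phi> (refined_unified_diagrams (caracol (r + 3)) (r + 2) i)
                 (multi_labeled_dyck_paths r i)) \<and>
         card (multi_labeled_dyck_paths r i) = T r i"
proof -
  \<comment> \<open>The bijection runs through \<open>flow_diagrams\<close> and
    \<open>labelled_columns\<close>; the map \<open>split_columns\<close> between them is
    inverted.\<close>
  have "\<exists>\<Phi>. bij_betw \<Phi> (refined_unified_diagrams (caracol (r + 3)) (r + 2) i)
      (multi_labeled_dyck_paths r i)"
    using bij_betw_refined_unified_flow[OF assms]
      bij_betw_inv_into[OF bij_betw_labelled_columns_flow[OF assms]]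
      bij_betw_labelled_columns_multi_labeled[OF assms]
    by (blast intro: bij_betw_trans)
  then show ?thesis
    by (auto simp: T_def dest: bij_betw_same_card)
qed

end
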